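(* Let $\mathbb{F}$ be a field and let $\alpha,\beta\in\mathbb{F}$ with $\alpha\neq\beta$, $\alpha\neq 1$, $\beta\neq 1$. Let $A$ be a primitive $\mathcal{J}(\alpha,\beta)$-axial algebra over $\mathbb{F}$ satisfying the $(\star)$ condition. If $A$ is generated by three primitive axes $a,b,c$, then $A$ is spanned by $$a,\ b,\ c,\ [a]b,\ [a]c,\ [b]c,\ [a,b]c,\ [b,a]c,\ [c,a]b.$$ Moreover, if we denote $\delta=(a,b)$, $\theta=(a,c)$, $\gamma=(b,c)$, $\omega=(a,[b]c)$, then $$A_\alpha(a)=\Big\langle -2\delta a+b+[a]b,\ -2\theta a+c+[a]c,\ -2\omega a+[b]c+[a,b]c,\ \frac{t_1a-t(b+c)}{(\alpha-\beta)^2}+[b,a]c+[c,a]b\Big\rangle,$$ $$A_\beta(a)=\Big\langle -b+[a]b,\ -c+[a]c,\ -[b]c+[a,b]c,\ \frac{t}{(\alpha-\beta)^2}(b-c)-[b,a]c+[c,a]b\Big\rangle,$$ where $$t_1=-2\beta^2(-\omega+\delta+2\theta)-4\beta\delta(-2\theta+\gamma)+\alpha^2(\omega-\delta(1+2\gamma))+2\alpha\delta\gamma+2\alpha\beta(\theta+2\delta\theta-(2+\delta)\gamma)$$ and $$t=\alpha^2\big(2\omega+4\delta(\theta-\gamma)+2\theta-2\gamma+1\big)-2\alpha\big(\beta(\omega-\theta+\gamma)+\omega+(4\delta+1)(\theta-\gamma)\big)-\beta^2+2\beta(\omega-\theta+\gamma)+4\delta(\theta-\gamma).$$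
   Context: Algebras are commutative but not necessarily associative. For an element $a$ of an $\mathbb{F}$-algebra $A$ and $\lambda\in\mathbb{F}$, $A_\lambda(a)=\{x\in A: ax=\lambda x\}$ (possibly zero). $\langle\ldots\rangle$ denotes linear span. A $\mathcal{J}(\alpha,\beta)$-axis is a nonzero idempotent $a\in A$ such that $A=A_1(a)\oplus A_\alpha(a)\oplus A_\beta(a)$ and the fusion law holds: $A_1(a)A_\lambda(a)\subseteq A_\lambda(a)$ for $\lambda\in\{1,\alpha,\beta\}$, $A_\alpha(a)A_\alpha(a)\subseteq A_1(a)\oplus A_\alpha(a)$, $A_\alpha(a)A_\beta(a)\subseteq A_\beta(a)$, $A_\beta(a)A_\beta(a)\subseteq A_1(a)\oplus A_\alpha(a)$. "Axis" means $\mathcal{J}(\alpha,\beta)$-axis. An axis $a$ is primitive if $A_1(a)=\langle a\rangle$. A primitive $\mathcal{J}(\alpha,\beta)$-axial algebra is a commutative algebra generated (as an algebra) by a set of primitive $\mathcal{J}(\alpha,\beta)$-axes. Condition $(\star)$: for any two primitive axes $a,b\in A$, if $b=\delta a+b_\alpha+b_\beta$ with $\delta\in\mathbb{F}$, $b_\alpha\in A_\alpha(a)$, $b_\beta\in A_\beta(a)$, then the projection of $a$ onto $A_1(b)$ (along $A_\alpha(b)\oplus A_\beta(b)$) equals $\delta b$. $(\cdot,\cdot)$ denotes the unique Frobenius form on $A$ (non-zero symmetric bilinear form with $(u,vw)=(uv,w)$ for all $u,v,w\in A$) such that $(a,a)=1$ for every primitive axis $a$; if $b=\delta a+b_\alpha+b_\beta$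 is the decomposition of a primitive axis $b$ with respect to a primitive axis $a$, then $(a,b)=\delta$. For an axis $a$, the Miyamoto involution $\tau_a$ is the automorphism of $A$ acting as $+1$ on $A_1(a)\oplus A_\alpha(a)$ and as $-1$ on $A_\beta(a)$. Notation: $[a]x=\tau_a(x)$ and $[a_1,\ldots,a_l]x=\tau_{a_1}(\tau_{a_2}(\cdots\tau_{a_l}(x)))$.
   Formalization: The field is assumed to have characteristic different from 2 (the eigenspace description fails there unless A is one-dimensional), and the last three summands of t_1 are multiplied by -2, since the printed t_1 already fails for A=<a>, a=b=c. *)

theory Defs
  imports Complex_Main "HOL-Library.Set_Algebras"
begin

text \<open>
  The algebra is the whole type \<open>'a\<close>, with scalar multiplication \<open>*s\<close> over the field \<open>'f\<close>.
  Sums \<open>U + V\<close> of sets are the elementwise sums of \<open>HOL-Library.Set_Algebras\<close>.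
\<close>

locale comm_algebra = vector_space scale
  for scale :: "'f::field \<Rightarrow> 'a::ab_group_add \<Rightarrow> 'a" (infixr "*s" 75) +
  fixes mult :: "'a \<Rightarrow> 'a \<Rightarrow> 'a" (infixl "\<cdot>" 70)
  assumes mult_commute: "x \<cdot> y = y \<cdot> x"
    and linear_mult: "Vector_Spaces.linear (*s) (*s) (\<lambda>y. x \<cdot> y)"
begin

definition subalgebra :: "'a set \<Rightarrow> bool" where
  "subalgebra B \<longleftrightarrow> subspace B \<and> (\<forall>x\<in>B. \<forall>y\<in>B. x \<cdot> y \<in> B)"

definition generates :: "'a set \<Rightarrow> bool" where
  "generates S \<longleftrightarrow> subalgebra hull S = UNIV"

definition eigenspace :: "'f \<Rightarrow> 'a \<Rightarrow> 'a set" where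
  "eigenspace l a = {x. a \<cdot> x = l *s x}"

definition is_direct_sum :: "'a set \<Rightarrow> 'a set \<Rightarrow> 'a set \<Rightarrow> bool" where
  "is_direct_sum U V W \<longleftrightarrow>
     (\<forall>x. \<exists>!(u, v, w). u \<in> U \<and> v \<in> V \<and> w \<in> W \<and> x = u + v + w)"

definition axis :: "'f \<Rightarrow> 'f \<Rightarrow> 'a \<Rightarrow> bool" where
  "axis \<alpha> \<beta> a \<longleftrightarrow>
     a \<noteq> 0 \<and> a \<cdot> a = a \<and>
     is_direct_sum (eigenspace 1 a) (eigenspace \<alpha> a) (eigenspace \<beta> a) \<and>
     (\<forall>l\<in>{1, \<alpha>, \<beta>}. \<forall>x\<in>eigenspace 1 a. \<forall>y\<in>eigenspace l a. x \<cdot> y \<in> eigenspace l a) \<and>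
     (\<forall>x\<in>eigenspace \<alpha> a. \<forall>y\<in>eigenspace \<alpha> a. x \<cdot> y \<in> eigenspace 1 a + eigenspace \<alpha> a) \<and>
     (\<forall>x\<in>eigenspace \<alpha> a. \<forall>y\<in>eigenspace \<beta> a. x \<cdot> y \<in> eigenspace \<beta> a) \<and>
     (\<forall>x\<in>eigenspace \<beta> a. \<forall>y\<in>eigenspace \<beta> a. x \<cdot> y \<in> eigenspace 1 a + eigenspace \<alpha> a)"

definition primitive_axis :: "'f \<Rightarrow> 'f \<Rightarrow> 'a \<Rightarrow> bool" where
  "primitive_axis \<alpha> \<beta> a \<longleftrightarrow> axis \<alpha> \<beta> a \<and> eigenspace 1 a = span {a}"

definition primitive_axial_algebra :: "'f \<Rightarrow> 'f \<Rightarrow> bool" where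
  "primitive_axial_algebra \<alpha> \<beta> \<longleftrightarrow> (\<exists>S \<subseteq> Collect (primitive_axis \<alpha> \<beta>). generates S)"

text \<open>Projection onto \<open>A\<^sub>1(a)\<close> along \<open>A\<^sub>\<alpha>(a) \<oplus> A\<^sub>\<beta>(a)\<close>; meaningful when \<open>a\<close> is an axis.\<close>

definition proj1 :: "'f \<Rightarrow> 'f \<Rightarrow> 'a \<Rightarrow> 'a \<Rightarrow> 'a" where
  "proj1 \<alpha> \<beta> a x =
     (THE u. u \<in> eigenspace 1 a \<and> (\<exists>v\<in>eigenspace \<alpha> a. \<exists>w\<in>eigenspace \<beta> a. x = u + v + w))"

definition star_condition :: "'f \<Rightarrow> 'f \<Rightarrow> bool" where
  "star_condition \<alpha> \<beta> \<longleftrightarrow>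
     (\<forall>a b \<delta> b\<^sub>\<alpha> b\<^sub>\<beta>. primitive_axis \<alpha> \<beta> a \<longrightarrow> primitive_axis \<alpha> \<beta> b \<longrightarrow>
        b\<^sub>\<alpha> \<in> eigenspace \<alpha> a \<longrightarrow> b\<^sub>\<beta> \<in> eigenspace \<beta> a \<longrightarrow> b = \<delta> *s a + b\<^sub>\<alpha> + b\<^sub>\<beta> \<longrightarrow>
        proj1 \<alpha> \<beta> b a = \<delta> *s b)"

definition frobenius_form :: "('a \<Rightarrow> 'a \<Rightarrow> 'f) \<Rightarrow> bool" where
  "frobenius_form B \<longleftrightarrow>
     (\<exists>u v. B u v \<noteq> 0) \<and>
     (\<forall>u v. B u v = B v u) \<and>
     (\<forall>u. Vector_Spaces.linear (*s) (*) (\<lambda>v. B u v)) \<and>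
     (\<forall>v. Vector_Spaces.linear (*s) (*) (\<lambda>u. B u v)) \<and>
     (\<forall>u v w. B u (v \<cdot> w) = B (u \<cdot> v) w)"

definition the_form :: "'f \<Rightarrow> 'f \<Rightarrow> 'a \<Rightarrow> 'a \<Rightarrow> 'f" where
  "the_form \<alpha> \<beta> = (THE B. frobenius_form B \<and> (\<forall>a. primitive_axis \<alpha> \<beta> a \<longrightarrow> B a a = 1))"

definition automorphism :: "('a \<Rightarrow> 'a) \<Rightarrow> bool" where
  "automorphism f \<longleftrightarrow>
     bij f \<and> Vector_Spaces.linear (*s) (*s) f \<and> (\<forall>x y. f (x \<cdot> y) = f x \<cdot> f y)"

definition miyamoto :: "'f \<Rightarrow> 'f \<Rightarrow> 'a \<Rightarrow> 'a \<Rightarrow> 'a" where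
  "miyamoto \<alpha> \<beta> a =
     (THE f. automorphism f \<and>
        (\<forall>x \<in> eigenspace 1 a + eigenspace \<alpha> a. f x = x) \<and>
        (\<forall>x \<in> eigenspace \<beta> a. f x = - x))"

text \<open>\<open>miyamotos \<alpha> \<beta> [a\<^sub>1, \<dots>, a\<^sub>l] x\<close> applies the involution of \<open>a\<^sub>l\<close> first and that of \<open>a\<^sub>1\<close> last.\<close>

definition miyamotos :: "'f \<Rightarrow> 'f \<Rightarrow> 'a list \<Rightarrow> 'a \<Rightarrow> 'a" where
  "miyamotos \<alpha> \<beta> as x = foldr (miyamoto \<alpha> \<beta>) as x"

end

text \<open>
  The coefficients of the eigenvectors involving \<open>[b,a]c\<close> and \<open>[c,a]b\<close>, as functions of
  \<open>\<delta> = (a,b)\<close>, \<open>\<theta> = (a,c)\<close>, \<open>\<gamma> = (b,c)\<close>, \<open>\<omega> = (a,[b]c)\<close>.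

  In \<open>coeff_t1\<close> the factor \<open>- 2\<close> in front of the last bracket is essential: it makes the
  \<open>\<alpha>\<close>-eigenvector orthogonal to \<open>a\<close>. With \<open>1\<close> in its place, as the formula is also found
  written, the eigenspace description already fails for the one-dimensional algebra
  \<open>A = \<langle>a\<rangle>\<close>, \<open>a = b = c\<close>, where the vector becomes a nonzero multiple of \<open>a\<close> as soon as
  \<open>6\<alpha>(\<alpha> - 1) \<noteq> 0\<close>.
\<close>

definition coeff_t1 :: "'f::field \<Rightarrow> 'f \<Rightarrow> 'f \<Rightarrow> 'f \<Rightarrow> 'f \<Rightarrow> 'f \<Rightarrow> 'f" where
  "coeff_t1 \<alpha> \<beta> \<delta> \<theta> \<gamma> \<omega> =
     - 2 * \<beta>^2 * (- \<omega> + \<delta> + 2 * \<theta>) - 4 * \<beta> * \<delta> * (- 2 * \<theta> + \<gamma>)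
     - 2 * (\<alpha>^2 * (\<omega> - \<delta> * (1 + 2 * \<gamma>)) + 2 * \<alpha> * \<delta> * \<gamma>
            + 2 * \<alpha> * \<beta> * (\<theta> + 2 * \<delta> * \<theta> - (2 + \<delta>) * \<gamma>))"

definition coeff_t :: "'f::field \<Rightarrow> 'f \<Rightarrow> 'f \<Rightarrow> 'f \<Rightarrow> 'f \<Rightarrow> 'f \<Rightarrow> 'f" where
  "coeff_t \<alpha> \<beta> \<delta> \<theta> \<gamma> \<omega> =
     \<alpha>^2 * (2 * \<omega> + 4 * \<delta> * (\<theta> - \<gamma>) + 2 * \<theta> - 2 * \<gamma> + 1)
     - 2 * \<alpha> * (\<beta> * (\<omega> - \<theta> + \<gamma>) + \<omega> + (4 * \<delta> + 1) * (\<theta> - \<gamma>))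
     - \<beta>^2 + 2 * \<beta> * (\<omega> - \<theta> + \<gamma>) + 4 * \<delta> * (\<theta> - \<gamma>)"

end

theory Submission
  imports Defs
begin

text \<open>
  For a primitive axis \<open>a\<close>, multiplication by \<open>a\<close> is determined by the involution \<open>\<tau>\<^sub>a\<close> and the
  coefficient \<open>(a, x)\<close> of \<open>a\<close> in \<open>x\<close>:
  \<open>a x = (1 - \<alpha>) (a, x) a + (\<alpha> + \<beta>)/2 x + (\<alpha> - \<beta>)/2 \<tau>\<^sub>a x\<close>.
  As \<open>(\<star>)\<close> says that this coefficient is symmetric on axes, \<open>x y = y x\<close> turns into
  \<open>\<tau>\<^sub>x y = \<tau>\<^sub>y x + k (y - x)\<close> for axes \<open>x, y\<close>. Applied to the axes \<open>\<tau>\<^sub>a b\<close> and \<open>c\<close> this gives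
  \<open>\<tau>\<^sub>a \<tau>\<^sub>b \<tau>\<^sub>a c = \<tau>\<^sub>c \<tau>\<^sub>a b + k (c - \<tau>\<^sub>a b)\<close>, so the span of the nine words is stable under \<open>\<tau>\<^sub>a\<close>,
  \<open>\<tau>\<^sub>b\<close>, \<open>\<tau>\<^sub>c\<close>, hence under the involutions of all nine words, hence under multiplication.
  The eigenspaces of \<open>a\<close> are read off from the action of \<open>\<tau>\<^sub>a\<close> on the nine words.

  The algebra is thus spanned by axes, so there is at most one normalised Frobenius form. It exists
  because the coefficients extend bilinearly; invariance of the coefficients under \<open>\<tau>\<^sub>p\<close> makes
  the eigenspaces of each axis \<open>p\<close> pairwise orthogonal, which is associativity of the form for
  products with \<open>p\<close>.
\<close>

section \<open>Axes and automorphisms of commutative algebras\<close>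

context comm_algebra
begin

lemma mult_add_right: "x \<cdot> (y + z) = x \<cdot> y + x \<cdot> z"
  and mult_scale_right: "x \<cdot> (l *s y) = l *s (x \<cdot> y)"
  using linear_mult[of x] by (simp_all add: Vector_Spaces.linear_iff)

lemma mult_add_left: "(y + z) \<cdot> x = y \<cdot> x + z \<cdot> x"
  and mult_scale_left: "(l *s y) \<cdot> x = l *s (y \<cdot> x)"
  by (simp_all add: mult_commute[of _ x] mult_add_right mult_scale_right)

lemma subspace_mult_preimage:
  assumes "subspace W"
  shows "subspace {x. x \<cdot> y \<in> W}"
proof (rule subspaceI)
  have "0 \<cdot> y = 0"
    using mult_scale_left[of 0 0 y] by simp
  then show "0 \<in> {x. x \<cdot> y \<in> W}"
    using subspace_0[OF assms] by simp
qed (auto simp: mult_add_left mult_scale_left intro: subspace_add[OF assms] subspace_scale[OF assms])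

lemma subspace_eigenspace: "subspace (eigenspace l a)"
proof (rule subspaceI)
  have "a \<cdot> 0 = 0"
    using mult_scale_right[of a 0 0] by simp
  then show "0 \<in> eigenspace l a"
    by (simp add: eigenspace_def)
qed (auto simp: eigenspace_def mult_add_right mult_scale_right scale_right_distrib mult.commute)

section \<open>Direct sums of three sets and their images\<close>

lemma is_direct_sumD:
  assumes "is_direct_sum U V W" "u \<in> U" "v \<in> V" "w \<in> W" "u' \<in> U" "v' \<in> V" "w' \<in> W"
    and "u + v + w = u' + v' + w'"
  shows "u = u' \<and> v = v' \<and> w = w'"
proof -
  have "\<exists>!(x, y, z). x \<in> U \<and> y \<in> V \<and> z \<in> W \<and> u + v + w = x + y + z"
    using assms(1) unfolding is_direct_sum_def by blast
  then have "(u, v, w) = (u', v', w')"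
    using assms(2-) by (elim ex1E) (metis (mono_tags, lifting) case_prodI)
  then show ?thesis by simp
qed

lemma is_direct_sum_decomposition:
  assumes "is_direct_sum U V W"
  shows "\<exists>u\<in>U. \<exists>v\<in>V. \<exists>w\<in>W. x = u + v + w"
  using assms unfolding is_direct_sum_def by fast

lemma is_direct_sum_image:
  assumes "is_direct_sum U V W" "bij f" and add: "\<And>x y. f (x + y) = f x + f y"
  shows "is_direct_sum (f ` U) (f ` V) (f ` W)"
  unfolding is_direct_sum_def
proof (intro allI)
  fix x
  obtain y where y: "x = f y"
    using \<open>bij f\<close> by (metis bij_pointE)
  obtain u v w where uvw: "u \<in> U" "v \<in> V" "w \<in> W" "y = u + v + w"
    using is_direct_sum_decomposition[OF assms(1)] by blast
  have "u' = u \<and> v' = v \<and> w' = w"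
    if "u' \<in> U" "v' \<in> V" "w' \<in> W" "x = f u' + f v' + f w'" for u' v' w'
  proof (rule is_direct_sumD[OF assms(1)])
    have "f (u' + v' + w') = f (u + v + w)"
      using that uvw y by (simp add: add)
    then show "u' + v' + w' = u + v + w"
      using \<open>bij f\<close> by (simp add: bij_def inj_eq)
  qed (use that uvw in auto)
  then show "\<exists>!(u, v, w). u \<in> f ` U \<and> v \<in> f ` V \<and> w \<in> f ` W \<and> x = u + v + w"
    using uvw y by (intro ex1I[of _ "(f u, f v, f w)"]) (auto simp: add)
qed

section \<open>Automorphisms and the transport of primitive axes\<close>

lemma automorphism_add: "automorphism f \<Longrightarrow> f (x + y) = f x + f y"
  and automorphism_scale: "automorphism f \<Longrightarrow> f (l *s x) = l *s f x"
  and automorphism_mult: "automorphism f \<Longrightarrow> f (x \<cdot> y) = f x \<cdot> f y"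
  and automorphism_bij: "automorphism f \<Longrightarrow> bij f"
  by (simp_all add: automorphism_def Vector_Spaces.linear_iff)

lemma automorphism_zero: "automorphism f \<Longrightarrow> f 0 = 0"
  using automorphism_scale[of f 0 0] by simp

lemma automorphism_minus: "automorphism f \<Longrightarrow> f (- x) = - f x"
  using automorphism_scale[of f "- 1" x] by simp

lemma automorphism_diff: "automorphism f \<Longrightarrow> f (x - y) = f x - f y"
  using automorphism_add[of f x "- y"] by (simp add: automorphism_minus)

lemmas automorphism_simps =
  automorphism_add automorphism_scale automorphism_zero automorphism_minus automorphism_diff

lemma eigenspace_automorphism:
  assumes f: "automorphism f"
  shows "eigenspace l (f a) = f ` eigenspace l a"
proof (intro set_eqI iffI)
  fix x assume "x \<in> eigenspace l (f a)"
  moreover obtain y where y: "x = f y"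
    using automorphism_bij[OF f] by (metis bij_pointE)
  ultimately have "f (a \<cdot> y) = f (l *s y)"
    by (simp add: eigenspace_def automorphism_mult[OF f] automorphism_scale[OF f])
  then have "a \<cdot> y = l *s y"
    using automorphism_bij[OF f] by (simp add: bij_def inj_eq)
  then show "x \<in> f ` eigenspace l a"
    by (simp add: y eigenspace_def)
qed (auto simp: eigenspace_def automorphism_mult[OF f, symmetric] automorphism_scale[OF f, symmetric])

text \<open>Every clause of the definition is phrased through the product and the eigenspaces of
  \<open>a\<close>, and \<open>f\<close> maps these onto the eigenspaces of \<open>f a\<close>.
  Consequently all words in the involutions, applied to axes, are again axes.\<close>

lemma primitive_axis_automorphism:
  assumes f: "automorphism f" and a: "primitive_axis \<alpha> \<beta> a"
  shows "primitive_axis \<alpha> \<beta> (f a)"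
proof -
  have plus: "f ` U + f ` V = f ` (U + V)" for U V
  proof (intro subset_antisym subsetI)
    fix x assume "x \<in> f ` U + f ` V"
    then obtain u v where uv: "u \<in> U" "v \<in> V" "x = f u + f v"
      by (auto elim!: set_plus_elim)
    then have "x = f (u + v)"
      by (simp add: automorphism_add[OF f])
    then show "x \<in> f ` (U + V)"
      using set_plus_intro[OF uv(1,2)] by blast
  next
    fix x assume "x \<in> f ` (U + V)"
    then obtain u v where uv: "u \<in> U" "v \<in> V" "x = f (u + v)"
      by (auto elim!: set_plus_elim)
    then show "x \<in> f ` U + f ` V"
      unfolding uv(3) automorphism_add[OF f] by (intro set_plus_intro imageI)
  qed
  have "f a \<noteq> 0"
    using a automorphism_zero[OF f] inj_eq[OF bij_is_inj[OF automorphism_bij[OF f]], of a 0]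
    by (simp add: primitive_axis_def axis_def)
  moreover have "f a \<cdot> f a = f a"
    using a automorphism_mult[OF f, of a a] by (simp add: primitive_axis_def axis_def)
  moreover have axis: "axis \<alpha> \<beta> a" and span: "eigenspace 1 a = span {a}"
    using a by (simp_all add: primitive_axis_def)
  ultimately have "axis \<alpha> \<beta> (f a)"
    using is_direct_sum_image[OF _ automorphism_bij[OF f] automorphism_add[OF f]] axis
    unfolding axis_def eigenspace_automorphism[OF f] plus
    by (simp add: automorphism_mult[OF f, symmetric])
  moreover have "eigenspace 1 (f a) = span {f a}"
    by (simp add: span eigenspace_automorphism[OF f] span_singleton automorphism_scale[OF f] image_image)
  ultimately show ?thesis
    by (simp add: primitive_axis_def)
qed

end

section \<open>Primitive axes under the star condition\<close>

text \<open>That 2 is nonzero separates the signs +1 and -1 of the involutions and permits the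
  divisions by 2 in the formula for multiplication by an axis.\<close>

locale star_algebra = comm_algebra scale mult
  for scale :: "'f::field \<Rightarrow> 'a::ab_group_add \<Rightarrow> 'a" (infixr "*s" 75)
    and mult :: "'a \<Rightarrow> 'a \<Rightarrow> 'a" (infixl "\<cdot>" 70) +
  fixes \<alpha> \<beta> :: 'f
  assumes two_neq_0: "(2::'f) \<noteq> 0"
    and params: "\<alpha> \<noteq> \<beta>" "\<alpha> \<noteq> 1" "\<beta> \<noteq> 1"
    and star: "star_condition \<alpha> \<beta>"
begin

abbreviation "prim \<equiv> primitive_axis \<alpha> \<beta>"
abbreviation "\<tau> \<equiv> miyamoto \<alpha> \<beta>"

lemma halves: "(\<alpha> + \<beta>) / 2 + (\<alpha> - \<beta>) / 2 = \<alpha>" "(\<alpha> + \<beta>) / 2 - (\<alpha> - \<beta>) / 2 = \<beta>"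
  using two_neq_0 by (simp_all flip: add_divide_distrib diff_divide_distrib mult_2)

section \<open>Components with respect to a primitive axis\<close>

lemma prim_neq_0: "prim a \<Longrightarrow> a \<noteq> 0"
  and prim_idem: "prim a \<Longrightarrow> a \<cdot> a = a"
  by (simp_all add: primitive_axis_def axis_def)

lemma prim_scale_eigenspace: "prim a \<Longrightarrow> l *s a \<in> eigenspace 1 a"
  by (simp add: eigenspace_def mult_scale_right prim_idem)

lemma prim_decomposition:
  assumes "prim a"
  obtains l v w where "v \<in> eigenspace \<alpha> a" "w \<in> eigenspace \<beta> a" "x = l *s a + v + w"
proof -
  obtain u v w where "u \<in> eigenspace 1 a" "v \<in> eigenspace \<alpha> a" "w \<in> eigenspace \<beta> a" "x = u + v + w"
    using is_direct_sum_decomposition assms unfolding primitive_axis_def axis_def by metis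
  moreover obtain l where "u = l *s a"
    using assms \<open>u \<in> eigenspace 1 a\<close> by (auto simp: primitive_axis_def span_singleton)
  ultimately show thesis using that by blast
qed

lemma prim_decomposition_unique:
  assumes a: "prim a" and "v \<in> eigenspace \<alpha> a" "w \<in> eigenspace \<beta> a" "v' \<in> eigenspace \<alpha> a" "w' \<in> eigenspace \<beta> a"
    and "l *s a + v + w = l' *s a + v' + w'"
  shows "l = l'" "v = v'" "w = w'"
proof -
  have "l *s a = l' *s a \<and> v = v' \<and> w = w'"
    by (rule is_direct_sumD[of "eigenspace 1 a" "eigenspace \<alpha> a" "eigenspace \<beta> a"])
      (use assms prim_scale_eigenspace in \<open>auto simp: primitive_axis_def axis_def\<close>)
  then show "l = l'" "v = v'" "w = w'"
    using prim_neq_0[OF a] by auto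
qed

text \<open>This scalar turns out to be the value (a, x) of the Frobenius form. It is introduced
  independently of the form, because the form is constructed from it.\<close>

definition coeff1 :: "'a \<Rightarrow> 'a \<Rightarrow> 'f" where
  "coeff1 a x = (THE l. \<exists>v\<in>eigenspace \<alpha> a. \<exists>w\<in>eigenspace \<beta> a. x = l *s a + v + w)"

lemma coeff1_decomposition:
  assumes "prim a" "v \<in> eigenspace \<alpha> a" "w \<in> eigenspace \<beta> a"
  shows "coeff1 a (l *s a + v + w) = l"
  unfolding coeff1_def using assms prim_decomposition_unique(1) by (intro the_equality) blast+

lemma coeff1_add:
  assumes a: "prim a"
  shows "coeff1 a (x + y) = coeff1 a x + coeff1 a y"
proof -
  obtain l v w where x: "v \<in> eigenspace \<alpha> a" "w \<in> eigenspace \<beta> a" "x = l *s a + v + w"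
    by (rule prim_decomposition[OF a])
  obtain l' v' w' where y: "v' \<in> eigenspace \<alpha> a" "w' \<in> eigenspace \<beta> a" "y = l' *s a + v' + w'"
    by (rule prim_decomposition[OF a])
  have "x + y = (l + l') *s a + (v + v') + (w + w')"
    by (simp add: x y scale_left_distrib)
  then have "coeff1 a (x + y) = l + l'"
    using coeff1_decomposition[OF a] x(1,2) y(1,2) by (simp add: subspace_add[OF subspace_eigenspace])
  then show ?thesis
    using coeff1_decomposition[OF a] x y by simp
qed

lemma coeff1_scale:
  assumes a: "prim a"
  shows "coeff1 a (k *s x) = k * coeff1 a x"
proof -
  obtain l v w where x: "v \<in> eigenspace \<alpha> a" "w \<in> eigenspace \<beta> a" "x = l *s a + v + w"
    by (rule prim_decomposition[OF a])
  have "k *s x = (k * l) *s a + k *s v + k *s w"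
    by (simp add: x scale_right_distrib)
  then have "coeff1 a (k *s x) = k * l"
    using coeff1_decomposition[OF a] x(1,2) by (simp add: subspace_scale[OF subspace_eigenspace])
  then show ?thesis
    using coeff1_decomposition[OF a] x by simp
qed

lemma coeff1_minus: "prim a \<Longrightarrow> coeff1 a (- x) = - coeff1 a x"
  using coeff1_scale[of a "- 1" x] by simp

lemma coeff1_diff: "prim a \<Longrightarrow> coeff1 a (x - y) = coeff1 a x - coeff1 a y"
  using coeff1_add[of a x "- y"] by (simp add: coeff1_minus)

lemmas coeff1_simps = coeff1_add coeff1_scale coeff1_minus coeff1_diff

lemma coeff1_self: "prim a \<Longrightarrow> coeff1 a a = 1"
  using coeff1_decomposition[of a 0 0 1] by (simp add: subspace_0[OF subspace_eigenspace])

text \<open>The projection of \<open>a\<close> onto the 1-eigenspace of \<open>b\<close> is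
  evaluated twice: by uniqueness of the decomposition and by the star condition. Both values are
  multiples of the nonzero vector \<open>b\<close>.\<close>

lemma coeff1_sym:
  assumes a: "prim a" and b: "prim b"
  shows "coeff1 a b = coeff1 b a"
proof -
  obtain l v w where ab: "v \<in> eigenspace \<alpha> a" "w \<in> eigenspace \<beta> a" "b = l *s a + v + w"
    by (rule prim_decomposition[OF a])
  obtain l' v' w' where ba: "v' \<in> eigenspace \<alpha> b" "w' \<in> eigenspace \<beta> b" "a = l' *s b + v' + w'"
    by (rule prim_decomposition[OF b])
  have "proj1 \<alpha> \<beta> b a = l' *s b"
    unfolding proj1_def
  proof (rule the_equality)
    show "l' *s b \<in> eigenspace 1 b \<and> (\<exists>v\<in>eigenspace \<alpha> b. \<exists>w\<in>eigenspace \<beta> b. a = l' *s b + v + w)"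
      using ba prim_scale_eigenspace[OF b] by blast
    fix u assume u: "u \<in> eigenspace 1 b \<and> (\<exists>v\<in>eigenspace \<alpha> b. \<exists>w\<in>eigenspace \<beta> b. a = u + v + w)"
    then obtain k where "u = k *s b"
      using b by (auto simp: primitive_axis_def span_singleton)
    then show "u = l' *s b"
      using u ba prim_decomposition_unique(1)[OF b] by metis
  qed
  moreover have "proj1 \<alpha> \<beta> b a = l *s b"
    using star a b ab unfolding star_condition_def by blast
  ultimately have "l = l'"
    using prim_neq_0[OF b] by simp
  then show ?thesis
    using coeff1_decomposition[OF a ab(1,2)] coeff1_decomposition[OF b ba(1,2)] ab(3) ba(3) by metis
qed

section \<open>The Miyamoto involution of a primitive axis\<close>

text \<open>The fusion law is read as a grading modulo 2: the 1- and \<alpha>-eigenspaces are even,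
  the \<beta>-eigenspace is odd. By primitivity even elements have the form
  \<open>k *s a + v\<close>.\<close>

lemma mult_parity:
  assumes a: "prim a"
    and v: "v \<in> eigenspace \<alpha> a" and w: "w \<in> eigenspace \<beta> a"
    and v': "v' \<in> eigenspace \<alpha> a" and w': "w' \<in> eigenspace \<beta> a"
  shows "(k *s a + v) \<cdot> (k' *s a + v') \<in> eigenspace 1 a + eigenspace \<alpha> a"
    and "(k *s a + v) \<cdot> w \<in> eigenspace \<beta> a"
    and "w \<cdot> w' \<in> eigenspace 1 a + eigenspace \<alpha> a"
proof -
  have even: "\<exists>k v. x = k *s a + v \<and> v \<in> eigenspace \<alpha> a" if "x \<in> eigenspace 1 a + eigenspace \<alpha> a" for x
    using that a by (auto elim!: set_plus_elim simp: primitive_axis_def span_singleton)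
  have "v \<cdot> v' \<in> eigenspace 1 a + eigenspace \<alpha> a"
    using a v v' unfolding primitive_axis_def axis_def by blast
  then obtain m u where mu: "v \<cdot> v' = m *s a + u" "u \<in> eigenspace \<alpha> a"
    using even by blast
  have "(k *s a + v) \<cdot> (k' *s a + v') = (k * k' + m) *s a + (k *s \<alpha> *s v' + k' *s \<alpha> *s v + u)"
    using v v' mu prim_idem[OF a] mult_commute[of v a]
    by (simp add: mult_add_left mult_add_right mult_scale_left mult_scale_right eigenspace_def algebra_simps)
  moreover have "k *s \<alpha> *s v' + k' *s \<alpha> *s v + u \<in> eigenspace \<alpha> a"
    using v v' mu(2) by (intro subspace_add[OF subspace_eigenspace] subspace_scale[OF subspace_eigenspace])
  ultimately show "(k *s a + v) \<cdot> (k' *s a + v') \<in> eigenspace 1 a + eigenspace \<alpha> a"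
    using prim_scale_eigenspace[OF a] by (metis set_plus_intro)
  have "(k *s a + v) \<cdot> w = k *s \<beta> *s w + v \<cdot> w"
    using w by (simp add: mult_add_left mult_scale_left eigenspace_def)
  moreover have "v \<cdot> w \<in> eigenspace \<beta> a"
    using a v w unfolding primitive_axis_def axis_def by blast
  ultimately show "(k *s a + v) \<cdot> w \<in> eigenspace \<beta> a"
    using w by (metis subspace_add[OF subspace_eigenspace] subspace_scale[OF subspace_eigenspace])
  show "w \<cdot> w' \<in> eigenspace 1 a + eigenspace \<alpha> a"
    using a w w' unfolding primitive_axis_def axis_def by blast
qed

text \<open>The map that negates the \<beta>-component is multiplicative because of the grading. Any
  other candidate agrees with it on the three summands, so the definite description in
  \<open>miyamoto\<close> denotes it.\<close>

lemma miyamoto_properties: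
  assumes a: "prim a"
  shows miyamoto_automorphism: "automorphism (\<tau> a)"
    and miyamoto_plus: "x \<in> eigenspace 1 a + eigenspace \<alpha> a \<Longrightarrow> \<tau> a x = x"
    and miyamoto_minus: "x \<in> eigenspace \<beta> a \<Longrightarrow> \<tau> a x = - x"
proof -
  \<comment> \<open>The product formula for \<open>a \<cdot> x\<close> is solved for the involution,
    so that linearity of \<open>f\<close> follows directly from that of \<open>coeff1\<close> and of
    the product.\<close>
  define f where "f x = (2 / (\<alpha> - \<beta>)) *s (a \<cdot> x - ((1 - \<alpha>) * coeff1 a x) *s a - ((\<alpha> + \<beta>) / 2) *s x)" for x
  have f_eq: "f (l *s a + v + w) = l *s a + v - w"
    if "v \<in> eigenspace \<alpha> a" "w \<in> eigenspace \<beta> a" for l v w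
  proof -
    define p q where "p = (\<alpha> + \<beta>) / 2" and "q = (\<alpha> - \<beta>) / 2"
    have pq: "\<alpha> = p + q" "\<beta> = p - q"
      using halves by (simp_all add: p_def q_def)
    have "a \<cdot> v = (p + q) *s v" "a \<cdot> w = (p - q) *s w"
      using that by (simp_all add: eigenspace_def pq)
    then have "a \<cdot> (l *s a + v + w) - ((1 - \<alpha>) * l) *s a - p *s (l *s a + v + w) = q *s (l *s a + v - w)"
      by (simp add: mult_add_right mult_scale_right prim_idem[OF a] pq algebra_simps)
    moreover have "2 / (\<alpha> - \<beta>) * q = 1"
      using params two_neq_0 by (simp add: q_def)
    ultimately show ?thesis
      by (simp add: f_def p_def coeff1_decomposition[OF a that])
  qed
  have f_add: "f (x + y) = f x + f y" for x y
    by (simp add: f_def coeff1_add[OF a] mult_add_right algebra_simps)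
  have f_scale: "f (k *s x) = k *s f x" for k x
    by (simp add: f_def coeff1_scale[OF a] mult_scale_right scale_right_diff_distrib algebra_simps)
  have f_plus: "f x = x" if x: "x \<in> eigenspace 1 a + eigenspace \<alpha> a" for x
  proof -
    obtain k v where "x = k *s a + v" "v \<in> eigenspace \<alpha> a"
      using x a by (auto elim!: set_plus_elim simp: primitive_axis_def span_singleton)
    then show ?thesis
      using f_eq[of v 0 k] by (simp add: subspace_0[OF subspace_eigenspace])
  qed
  have f_minus: "f x = - x" if x: "x \<in> eigenspace \<beta> a" for x
    using f_eq[of 0 x 0] x by (simp add: subspace_0[OF subspace_eigenspace])
  have f_f: "f (f x) = x" for x
  proof -
    obtain l v w where x: "v \<in> eigenspace \<alpha> a" "w \<in> eigenspace \<beta> a" "x = l *s a + v + w"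
      by (rule prim_decomposition[OF a])
    then have "f (f x) = f (l *s a + v + (- w))"
      using f_eq by simp
    also have "\<dots> = x"
      using f_eq[of v "- w" l] x by (simp add: subspace_neg[OF subspace_eigenspace])
    finally show ?thesis .
  qed
  have f_mult: "f (x \<cdot> y) = f x \<cdot> f y" for x y
  proof -
    obtain l v w where x: "v \<in> eigenspace \<alpha> a" "w \<in> eigenspace \<beta> a" "x = l *s a + v + w"
      by (rule prim_decomposition[OF a])
    obtain l' v' w' where y: "v' \<in> eigenspace \<alpha> a" "w' \<in> eigenspace \<beta> a" "y = l' *s a + v' + w'"
      by (rule prim_decomposition[OF a])
    let ?e = "l *s a + v" and ?e' = "l' *s a + v'"
    have fe: "f x = ?e + (- 1) *s w" "f y = ?e' + (- 1) *s w'"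
      using f_eq x y by simp_all
    \<comment> \<open>The product is split into two even and two odd terms; \<open>f\<close> fixes
      the former and negates the latter.\<close>
    have "x \<cdot> y = ?e \<cdot> ?e' + ?e \<cdot> w' + ?e' \<cdot> w + w \<cdot> w'"
      unfolding x(3) y(3) by (simp only: mult_add_left mult_add_right mult_commute[of w] ac_simps)
    also have "f \<dots> = ?e \<cdot> ?e' - ?e \<cdot> w' - ?e' \<cdot> w + w \<cdot> w'"
      by (simp only: f_add f_plus[OF mult_parity(1)[OF a x(1,2) y(1,2)]]
          f_plus[OF mult_parity(3)[OF a x(1,2) y(1,2)]]
          f_minus[OF mult_parity(2)[OF a x(1) y(2) y(1) y(2)]]
          f_minus[OF mult_parity(2)[OF a y(1) x(2) y(1) y(2)]] diff_conv_add_uminus)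
    also have "\<dots> = f x \<cdot> f y"
      unfolding fe mult_add_left[of ?e] mult_add_right[of _ ?e'] mult_scale_left mult_scale_right mult_commute[of w ?e']
      by (simp add: algebra_simps)
    finally show ?thesis .
  qed
  have "automorphism f"
    unfolding automorphism_def
    by (auto simp: Vector_Spaces.linear_iff vector_space_axioms f_add f_scale f_mult intro!: o_bij[of f f] f_f ext)
  moreover have "g = f" if g: "automorphism g" "\<forall>x\<in>eigenspace 1 a + eigenspace \<alpha> a. g x = x"
    "\<forall>x\<in>eigenspace \<beta> a. g x = - x" for g
  proof
    fix x
    obtain l v w where x: "v \<in> eigenspace \<alpha> a" "w \<in> eigenspace \<beta> a" "x = l *s a + v + w"
      by (rule prim_decomposition[OF a])
    have "g x = g (l *s a + v) + g w"
      unfolding x by (rule automorphism_add[OF g(1)])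
    also have "\<dots> = l *s a + v - w"
      using g(2,3) x prim_scale_eigenspace[OF a] by auto
    finally show "g x = f x"
      using f_eq x by simp
  qed
  ultimately have "\<tau> a = f"
    unfolding miyamoto_def using f_plus f_minus by (intro the_equality) blast+
  then show "automorphism (\<tau> a)"
    and "x \<in> eigenspace 1 a + eigenspace \<alpha> a \<Longrightarrow> \<tau> a x = x"
    and "x \<in> eigenspace \<beta> a \<Longrightarrow> \<tau> a x = - x"
    using \<open>automorphism f\<close> f_plus f_minus by simp_all
qed

lemmas miyamoto_simps = automorphism_simps[OF miyamoto_automorphism]

lemma prim_miyamoto: "prim a \<Longrightarrow> prim b \<Longrightarrow> prim (\<tau> a b)"
  by (rule primitive_axis_automorphism[OF miyamoto_automorphism])

lemma miyamoto_decomposition: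
  assumes "prim a" "v \<in> eigenspace \<alpha> a" "w \<in> eigenspace \<beta> a"
  shows "\<tau> a (l *s a + v + w) = l *s a + v - w"
  using assms miyamoto_plus[of a "l *s a + v"] miyamoto_minus[of a w] prim_scale_eigenspace[of a l]
  by (simp add: miyamoto_simps(1)[OF assms(1), of "l *s a + v"] set_plus_intro)

lemma miyamoto_self:
  assumes a: "prim a"
  shows "\<tau> a a = a"
  using miyamoto_decomposition[OF a, of 0 0 1] by (simp add: subspace_0[OF subspace_eigenspace])

lemma miyamoto_miyamoto:
  assumes a: "prim a"
  shows "\<tau> a (\<tau> a x) = x"
proof -
  obtain l v w where x: "v \<in> eigenspace \<alpha> a" "w \<in> eigenspace \<beta> a" "x = l *s a + v + w"
    by (rule prim_decomposition[OF a])
  show ?thesis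
    using miyamoto_decomposition[OF a x(1,2)] miyamoto_decomposition[OF a x(1), of "- w" l] x
    by (simp add: subspace_neg[OF subspace_eigenspace])
qed

lemma coeff1_miyamoto:
  assumes a: "prim a"
  shows "coeff1 a (\<tau> a x) = coeff1 a x"
proof -
  obtain l v w where x: "v \<in> eigenspace \<alpha> a" "w \<in> eigenspace \<beta> a" "x = l *s a + v + w"
    by (rule prim_decomposition[OF a])
  show ?thesis
    using miyamoto_decomposition[OF a x(1,2)] coeff1_decomposition[OF a x(1,2)]
      coeff1_decomposition[OF a x(1), of "- w" l] x
    by (simp add: subspace_neg[OF subspace_eigenspace])
qed

text \<open>An automorphism carries the decomposition of \<open>x\<close> with respect to
  \<open>a\<close> to that of \<open>f x\<close> with respect to \<open>f a\<close>; both the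
  coefficient and the involution are read off from it.\<close>

lemma conjugation:
  assumes f: "automorphism f" and a: "prim a"
  shows coeff1_automorphism: "coeff1 (f a) (f x) = coeff1 a x"
    and miyamoto_conjugate: "\<tau> (f a) (f x) = f (\<tau> a x)"
proof -
  obtain l v w where x: "v \<in> eigenspace \<alpha> a" "w \<in> eigenspace \<beta> a" "x = l *s a + v + w"
    by (rule prim_decomposition[OF a])
  have fx: "f x = l *s f a + f v + f w"
    by (simp add: x automorphism_simps[OF f])
  have fa: "prim (f a)" and fv: "f v \<in> eigenspace \<alpha> (f a)" and fw: "f w \<in> eigenspace \<beta> (f a)"
    using primitive_axis_automorphism[OF f a] x by (simp_all add: eigenspace_automorphism[OF f])
  show "coeff1 (f a) (f x) = coeff1 a x"
    unfolding fx coeff1_decomposition[OF fa fv fw] unfolding x(3) coeff1_decomposition[OF a x(1,2)] ..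
  show "\<tau> (f a) (f x) = f (\<tau> a x)"
    unfolding fx miyamoto_decomposition[OF fa fv fw]
    unfolding x(3) miyamoto_decomposition[OF a x(1,2)] by (simp add: automorphism_simps[OF f])
qed

text \<open>With p = (\<alpha> + \<beta>)/2 and q = (\<alpha> - \<beta>)/2, the last two terms act
  as p + q = \<alpha> on even components and as p - q = \<beta> on odd ones. The first term corrects
  the eigenvalue on \<open>a\<close> from \<alpha> to 1.\<close>

lemma mult_miyamoto:
  assumes a: "prim a"
  shows "a \<cdot> x = ((1 - \<alpha>) * coeff1 a x) *s a + ((\<alpha> + \<beta>) / 2) *s x + ((\<alpha> - \<beta>) / 2) *s \<tau> a x"
proof -
  define p q where "p = (\<alpha> + \<beta>) / 2" and "q = (\<alpha> - \<beta>) / 2"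
  have pq: "\<alpha> = p + q" "\<beta> = p - q"
    using halves by (simp_all add: p_def q_def)
  obtain l v w where x: "v \<in> eigenspace \<alpha> a" "w \<in> eigenspace \<beta> a" "x = l *s a + v + w"
    by (rule prim_decomposition[OF a])
  have "a \<cdot> v = (p + q) *s v" "a \<cdot> w = (p - q) *s w"
    using x by (simp_all add: eigenspace_def pq)
  then have "a \<cdot> x = ((1 - (p + q)) * l) *s a + p *s x + q *s (l *s a + v - w)"
    unfolding x(3) by (simp add: mult_add_right mult_scale_right prim_idem[OF a] algebra_simps)
  then show ?thesis
    unfolding p_def[symmetric] q_def[symmetric]
    by (simp add: x(3) miyamoto_decomposition[OF a x(1,2)] coeff1_decomposition[OF a x(1,2)] flip: pq(1))
qed

section \<open>Exchanging the two axes in an involution\<close>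

text \<open>The quotient of (1 - \<alpha>) l - (\<alpha> + \<beta>)/2 by (\<alpha> - \<beta>)/2: the
  factor of \<open>y - x\<close> in \<open>\<tau> x y - \<tau> y x\<close> for axes with coefficient
  l.\<close>

definition swap_coeff :: "'f \<Rightarrow> 'f" where
  "swap_coeff l = (2 * (1 - \<alpha>) * l - (\<alpha> + \<beta>)) / (\<alpha> - \<beta>)"

text \<open>Commutativity \<open>x \<cdot> y = y \<cdot> x\<close>, with both products expanded by \<open>mult_miyamoto\<close>.\<close>

lemma miyamoto_swap:
  assumes x: "prim x" and y: "prim y"
  shows "\<tau> x y = \<tau> y x + swap_coeff (coeff1 x y) *s (y - x)"
proof -
  define p q m where "p = (\<alpha> + \<beta>) / 2" and "q = (\<alpha> - \<beta>) / 2" and "m = (1 - \<alpha>) * coeff1 x y"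
  have q: "q \<noteq> 0" and qm: "q * swap_coeff (coeff1 x y) = m - p"
    using two_neq_0 params by (simp_all add: p_def q_def m_def swap_coeff_def field_simps)
  have "m *s x + p *s y + q *s \<tau> x y = m *s y + p *s x + q *s \<tau> y x"
    using mult_miyamoto[OF x, of y] mult_miyamoto[OF y, of x] mult_commute[of x y] coeff1_sym[OF x y]
    by (simp add: m_def p_def q_def)
  then have "q *s \<tau> x y = q *s \<tau> y x + (m - p) *s (y - x)"
    by (simp add: algebra_simps)
  also have "\<dots> = q *s (\<tau> y x + swap_coeff (coeff1 x y) *s (y - x))"
    by (simp add: scale_right_distrib flip: qm)
  finally show ?thesis
    using q scale_left_imp_eq by blast
qed

text \<open>By conjugation the left side is the involution of the axis \<open>\<tau> a b\<close>
  applied to \<open>c\<close>. Exchanging these two axes leaves only words with at most two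
  involutions.\<close>

lemma miyamoto_triple:
  assumes a: "prim a" and b: "prim b" and c: "prim c"
  shows "\<tau> a (\<tau> b (\<tau> a c)) = \<tau> c (\<tau> a b) + swap_coeff (coeff1 c (\<tau> a b)) *s (c - \<tau> a b)"
proof -
  have "\<tau> a (\<tau> b (\<tau> a c)) = \<tau> (\<tau> a b) c"
    using miyamoto_conjugate[OF miyamoto_automorphism[OF a] b, of "\<tau> a c"] miyamoto_miyamoto[OF a] by simp
  also have "\<dots> = \<tau> c (\<tau> a b) + swap_coeff (coeff1 c (\<tau> a b)) *s (c - \<tau> a b)"
    using miyamoto_swap[OF prim_miyamoto[OF a b] c] coeff1_sym[OF prim_miyamoto[OF a b] c] by simp
  finally show ?thesis .
qed

subsection \<open>Three generators\<close>

text \<open>Of any two words related by an exchange, such as \<open>\<tau> a b\<close> and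
  \<open>\<tau> b a\<close>, only one is listed. The list is therefore not symmetric in the three
  axes, although its span is.\<close>

definition word_span :: "'a \<Rightarrow> 'a \<Rightarrow> 'a \<Rightarrow> 'a set" where
  "word_span a b c = span {a, b, c, \<tau> a b, \<tau> a c, \<tau> b c, \<tau> a (\<tau> b c), \<tau> b (\<tau> a c), \<tau> c (\<tau> a b)}"

lemma in_word_span:
  "a \<in> word_span a b c" "b \<in> word_span a b c" "c \<in> word_span a b c"
  "\<tau> a b \<in> word_span a b c" "\<tau> a c \<in> word_span a b c" "\<tau> b c \<in> word_span a b c"
  "\<tau> a (\<tau> b c) \<in> word_span a b c" "\<tau> b (\<tau> a c) \<in> word_span a b c" "\<tau> c (\<tau> a b) \<in> word_span a b c"
  by (simp_all add: word_span_def span_base)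

text \<open>Exchanges rewrite the four rotated words that are absent from the list. The cyclic
  symmetry obtained in this way transfers stability under one involution to the other two.\<close>

lemma word_span_rotate:
  assumes a: "prim a" and b: "prim b" and c: "prim c"
  shows "word_span b c a \<subseteq> word_span a b c"
proof -
  have sub: "subspace (word_span a b c)"
    by (simp add: word_span_def)
  note closed = subspace_add[OF sub] subspace_diff[OF sub] subspace_scale[OF sub] in_word_span
  have ba: "\<tau> b a \<in> word_span a b c" and ca: "\<tau> c a \<in> word_span a b c" and cb: "\<tau> c b \<in> word_span a b c"
    using miyamoto_swap[OF b a] miyamoto_swap[OF c a] miyamoto_swap[OF c b] by (auto intro!: closed)
  have "\<tau> b (\<tau> c a) = \<tau> b (\<tau> a c) + swap_coeff (coeff1 c a) *s (\<tau> b a - \<tau> b c)"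
    by (simp add: miyamoto_swap[OF c a] miyamoto_simps[OF b])
  then have bca: "\<tau> b (\<tau> c a) \<in> word_span a b c"
    using ba by (auto intro!: closed)
  have "\<tau> c (\<tau> b a) = \<tau> c (\<tau> a b) + swap_coeff (coeff1 b a) *s (\<tau> c a - \<tau> c b)"
    by (simp add: miyamoto_swap[OF b a] miyamoto_simps[OF c])
  then have cba: "\<tau> c (\<tau> b a) \<in> word_span a b c"
    using ca cb by (auto intro!: closed)
  show ?thesis
    unfolding word_span_def[of b c a] using ba ca bca cba by (intro span_minimal sub) (auto intro: in_word_span)
qed

text \<open>The involution of \<open>a\<close> fixes \<open>a\<close> and interchanges
  \<open>b\<close> with \<open>\<tau> a b\<close>, \<open>c\<close> with \<open>\<tau> a c\<close>,
  and \<open>\<tau> b c\<close> with \<open>\<tau> a (\<tau> b c)\<close>. The two remaining words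
  are covered by \<open>miyamoto_triple\<close>.\<close>

lemma miyamoto_word_span:
  assumes a: "prim a" and b: "prim b" and c: "prim c" and "x \<in> word_span a b c"
  shows "\<tau> a x \<in> word_span a b c"
proof -
  have sub: "subspace (word_span a b c)"
    by (simp add: word_span_def)
  note closed = subspace_add[OF sub] subspace_diff[OF sub] subspace_scale[OF sub]
  have aba: "\<tau> a (\<tau> b (\<tau> a c)) \<in> word_span a b c"
    unfolding miyamoto_triple[OF a b c] by (auto intro!: closed in_word_span)
  have aca: "\<tau> a (\<tau> c (\<tau> a b)) \<in> word_span a b c"
    unfolding miyamoto_triple[OF a c b] by (auto intro!: closed in_word_span)
  have "subspace {x. \<tau> a x \<in> word_span a b c}"
    by (rule subspaceI) (auto simp: miyamoto_simps a intro!: closed subspace_0[OF sub])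
  moreover have "{a, b, c, \<tau> a b, \<tau> a c, \<tau> b c, \<tau> a (\<tau> b c), \<tau> b (\<tau> a c), \<tau> c (\<tau> a b)}
    \<subseteq> {x. \<tau> a x \<in> word_span a b c}"
    using aba aca by (auto simp: miyamoto_miyamoto a miyamoto_self intro: in_word_span)
  ultimately show ?thesis
    using span_minimal assms(4) unfolding word_span_def[of a b c] by blast
qed

lemma word_span_eq_UNIV:
  assumes a: "prim a" and b: "prim b" and c: "prim c" and gen: "generates {a, b, c}"
  shows "word_span a b c = UNIV"
proof -
  let ?W = "word_span a b c"
  let ?G = "{a, b, c, \<tau> a b, \<tau> a c, \<tau> b c, \<tau> a (\<tau> b c), \<tau> b (\<tau> a c), \<tau> c (\<tau> a b)}"
  have sub: "subspace ?W"
    by (simp add: word_span_def)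
  \<comment> \<open>Three rotations return to the start, so the inclusions are equalities.\<close>
  have "word_span b c a = ?W" "word_span c a b = ?W"
    using word_span_rotate[OF a b c] word_span_rotate[OF b c a] word_span_rotate[OF c a b] by auto
  then have stable: "\<tau> a x \<in> ?W" "\<tau> b x \<in> ?W" "\<tau> c x \<in> ?W" if "x \<in> ?W" for x
    using that miyamoto_word_span a b c by metis+
  \<comment> \<open>The involution of each word is thereby a composition of the involutions of the
    three generators.\<close>
  have conj: "\<tau> (\<tau> p q) x = \<tau> p (\<tau> q (\<tau> p x))" if "prim p" "prim q" for p q x
    using miyamoto_conjugate[OF miyamoto_automorphism[OF that(1)] that(2), of "\<tau> p x"] miyamoto_miyamoto[OF that(1)]
    by simp
  have "prim g \<and> (\<forall>x\<in>?W. \<tau> g x \<in> ?W)" if "g \<in> ?G" for g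
    using that a b c by (auto simp: prim_miyamoto conj stable)
  then have "g \<cdot> x \<in> ?W" if "g \<in> ?G" "x \<in> ?W" for g x
    using that by (auto simp: mult_miyamoto[of g x] word_span_def
        intro!: span_add span_scale span_base[of g])
  \<comment> \<open>With the right factor fixed, closure extends from the words to their span in the
    left factor.\<close>
  then have "?G \<subseteq> {y. y \<cdot> x \<in> ?W}" if "x \<in> ?W" for x
    using that by blast
  then have "?W \<subseteq> {y. y \<cdot> x \<in> ?W}" if "x \<in> ?W" for x
    using that span_minimal subspace_mult_preimage[OF sub] unfolding word_span_def by meson
  then have "subalgebra ?W"
    using sub by (auto simp: subalgebra_def)
  moreover have "{a, b, c} \<subseteq> ?W"
    unfolding word_span_def by (auto intro: span_base)
  ultimately show ?thesis
    using gen hull_minimal[of "{a, b, c}" ?W subalgebra] unfolding generates_def by blast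
qed

subsection \<open>The Frobenius form\<close>

lemma linear_eq_on_prim:
  assumes "span (Collect prim) = UNIV"
    and "Vector_Spaces.linear (*s) (*) f" "Vector_Spaces.linear (*s) (*) g"
    and "\<And>p. prim p \<Longrightarrow> f p = g p"
  shows "f x = g x"
proof -
  interpret vector_space_pair "(*s)" "(*) :: 'f \<Rightarrow> 'f \<Rightarrow> 'f"
    by unfold_locales (simp_all add: algebra_simps)
  show ?thesis
    by (rule linear_eq_on[of f g x "Collect prim"]) (use assms in auto)
qed

lemma linear_to_field_iff:
  "Vector_Spaces.linear (*s) (*) (f :: 'a \<Rightarrow> 'f) \<longleftrightarrow>
     (\<forall>x y. f (x + y) = f x + f y) \<and> (\<forall>l x. f (l *s x) = l * f x)"
proof -
  have "vector_space ((*) :: 'f \<Rightarrow> 'f \<Rightarrow> 'f)"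
    by unfold_locales (simp_all add: algebra_simps)
  then show ?thesis
    by (simp add: Vector_Spaces.linear_iff vector_space_axioms)
qed

lemma linear_coeff1: "prim a \<Longrightarrow> Vector_Spaces.linear (*s) (*) (coeff1 a)"
  by (simp add: linear_to_field_iff coeff1_simps)

text \<open>On a basis consisting of axes prescribe \<open>B p x = coeff1 p x\<close>; the condition \<open>(\<star>)\<close> makes
  this extend consistently to all axes.\<close>

lemma bilinear_extension_exists:
  assumes span: "span (Collect prim) = UNIV"
  obtains B where "\<And>p x. prim p \<Longrightarrow> B p x = coeff1 p x" "\<And>u v. B u v = B v u"
    "\<And>u. Vector_Spaces.linear (*s) (*) (B u)"
proof -
  interpret F: vector_space_pair "(*s)" "(*) :: 'f \<Rightarrow> 'f \<Rightarrow> 'f"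
    by unfold_locales (simp_all add: algebra_simps)
  obtain P where P: "P \<subseteq> Collect prim" "independent P" "Collect prim \<subseteq> span P"
    using maximal_independent_subset by blast
  have spanP: "span P = UNIV"
    using P(3) span span_minimal[OF P(3)] by auto
  have "\<exists>f. Vector_Spaces.linear (*s) (*) f \<and> (\<forall>p\<in>P. f p = coeff1 p x)" for x
    by (rule F.linear_independent_extend[OF P(2)])
  then obtain f where f: "\<And>x. Vector_Spaces.linear (*s) (*) (f x)" "\<And>x p. p \<in> P \<Longrightarrow> f x p = coeff1 p x"
    by metis
  have eq: "f x = g" if "Vector_Spaces.linear (*s) (*) g" "\<And>p. p \<in> P \<Longrightarrow> g p = coeff1 p x" for x g
    using F.linear_eq_on[OF f(1) that(1), of _ P x] f(2) that(2) spanP by auto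
  \<comment> \<open>Consistency outside the basis: for an axis q, \<open>coeff1 q\<close> is linear
    and by symmetry takes the prescribed values on \<open>P\<close>.\<close>
  have f_prim: "f q = coeff1 q" if "prim q" for q
    by (rule eq) (use that P(1) coeff1_sym linear_coeff1 in auto)
  have f_linear: "f x (u + v) = f x u + f x v" "f x (l *s u) = l * f x u" for x u v l
    using f(1) by (simp_all add: linear_to_field_iff)
  have prim_P: "prim p" if "p \<in> P" for p
    using that P(1) by blast
  \<comment> \<open>Linearity in the first argument: both sides are linear functionals with the same
    values on the basis \<open>P\<close>.\<close>
  have "f (x + y) = (\<lambda>u. f x u + f y u)" for x y
    by (rule eq) (simp_all add: linear_to_field_iff f_linear f(2) prim_P coeff1_add distrib_left)
  moreover have "f (l *s x) = (\<lambda>u. l * f x u)" for l x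
    by (rule eq) (simp_all add: linear_to_field_iff f_linear f(2) prim_P coeff1_scale distrib_left)
  ultimately have linear: "Vector_Spaces.linear (*s) (*) (\<lambda>x. f x u)" for u
    by (simp add: linear_to_field_iff)
  have f_prim': "f x q = coeff1 q x" if "prim q" for q x
    by (rule linear_eq_on_prim[OF span linear])
      (use that in \<open>auto simp: linear_coeff1 f_prim coeff1_sym\<close>)
  have "f u v = f v u" for u v
    by (rule linear_eq_on_prim[OF span f(1) linear]) (simp add: f_prim f_prim')
  then show thesis
    using that[of f] f(1) f_prim by simp
qed

text \<open>By linearity the middle factor may be taken to be an axis p. The eigenspaces of p are
  pairwise orthogonal for \<open>B\<close>, so multiplication by p is self-adjoint.\<close>

lemma bilinear_extension_frobenius:
  assumes span: "span (Collect prim) = UNIV"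
    and B: "\<And>p x. prim p \<Longrightarrow> B p x = coeff1 p x" "\<And>u v. B u v = B v u"
    and lin: "\<And>u. Vector_Spaces.linear (*s) (*) (B u)"
  shows "B u (v \<cdot> w) = B (u \<cdot> v) w"
proof -
  have lin': "Vector_Spaces.linear (*s) (*) (\<lambda>u. B u v)" for v
    using lin by (subst B(2))
  have add: "B x (y + z) = B x y + B x z" "B (y + z) x = B y x + B z x"
    and scale: "B x (l *s y) = l * B x y" "B (l *s y) x = l * B y x" for x y z l
    using lin lin' by (simp_all add: linear_to_field_iff)
  have invariant: "B (\<tau> p x) (\<tau> p y) = B x y" if p: "prim p" for p x y
  proof (rule linear_eq_on_prim[OF span, where x = x])
    show "Vector_Spaces.linear (*s) (*) (\<lambda>x. B (\<tau> p x) (\<tau> p y))"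
      by (simp add: linear_to_field_iff miyamoto_simps p add scale)
    show "B (\<tau> p q) (\<tau> p y) = B q y" if "prim q" for q
      using that p by (simp add: B(1) prim_miyamoto coeff1_automorphism[OF miyamoto_automorphism])
  qed (rule lin')
  have prim_case: "B u (p \<cdot> w) = B (u \<cdot> p) w" if p: "prim p" for p
  proof -
    obtain l v z where u: "v \<in> eigenspace \<alpha> p" "z \<in> eigenspace \<beta> p" "u = l *s p + v + z"
      by (rule prim_decomposition[OF p])
    obtain l' v' z' where w: "v' \<in> eigenspace \<alpha> p" "z' \<in> eigenspace \<beta> p" "w = l' *s p + v' + z'"
      by (rule prim_decomposition[OF p])
    have p_orth: "B p x = 0" "B x p = 0" if "x \<in> eigenspace \<alpha> p \<or> x \<in> eigenspace \<beta> p" for x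
    proof -
      have zero: "0 \<in> eigenspace m p" for m
        by (rule subspace_0[OF subspace_eigenspace])
      have "coeff1 p x = 0"
        using that coeff1_decomposition[OF p _ zero, of x 0] coeff1_decomposition[OF p zero, of x 0] by auto
      then show "B p x = 0" "B x p = 0"
        using B p by metis+
    qed
    \<comment> \<open>The involution of p fixes \<open>x\<close> and negates \<open>y\<close>, so
      invariance gives \<open>B x y = - B x y\<close>.\<close>
    have orth: "B x y = 0" "B y x = 0" if "x \<in> eigenspace \<alpha> p" "y \<in> eigenspace \<beta> p" for x y
    proof -
      have "\<tau> p x = x"
        using miyamoto_decomposition[OF p that(1) subspace_0[OF subspace_eigenspace], of 0] by simp
      moreover have "\<tau> p y = (- 1) *s y"
        using miyamoto_minus[OF p that(2)] by simp
      ultimately have "B x y = (- 1) * B x y"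
        using invariant[OF p, of x y, symmetric] by (simp only: scale)
      then have "B x y = - B x y"
        by simp
      then have "2 * B x y = 0"
        by (metis add.right_inverse mult_2)
      then show "B x y = 0" "B y x = 0"
        using two_neq_0 B(2) by simp_all
    qed
    have ev: "p \<cdot> v = \<alpha> *s v" "p \<cdot> z = \<beta> *s z" "p \<cdot> v' = \<alpha> *s v'" "p \<cdot> z' = \<beta> *s z'"
      using u w by (simp_all add: eigenspace_def)
    have "p \<cdot> w = l' *s p + \<alpha> *s v' + \<beta> *s z'" "p \<cdot> u = l *s p + \<alpha> *s v + \<beta> *s z"
      by (simp_all add: u(3) w(3) mult_add_right mult_scale_right ev prim_idem[OF p])
    then show ?thesis
      using u(1,2) w(1,2) unfolding mult_commute[of u p] by (simp add: u(3) w(3) add scale p_orth orth)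
  qed
  show ?thesis
  proof (rule linear_eq_on_prim[OF span, where f = "\<lambda>v. B u (v \<cdot> w)" and g = "\<lambda>v. B (u \<cdot> v) w"])
    show "Vector_Spaces.linear (*s) (*) (\<lambda>v. B u (v \<cdot> w))"
      by (simp add: linear_to_field_iff mult_add_left mult_scale_left add(1) scale(1))
    show "Vector_Spaces.linear (*s) (*) (\<lambda>v. B (u \<cdot> v) w)"
      by (simp add: linear_to_field_iff mult_add_right mult_scale_right add(2) scale(2))
  qed (rule prim_case)
qed

lemma frobenius_formD:
  assumes "frobenius_form B"
  shows "Vector_Spaces.linear (*s) (*) (B u)" "Vector_Spaces.linear (*s) (*) (\<lambda>u. B u v)"
    "B u (v \<cdot> w) = B (u \<cdot> v) w"
proof -
  note B = assms[unfolded frobenius_form_def, THEN conjunct2, THEN conjunct2]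
  show "Vector_Spaces.linear (*s) (*) (B u)"
    by (rule B[THEN conjunct1, THEN spec])
  show "Vector_Spaces.linear (*s) (*) (\<lambda>u. B u v)"
    by (rule B[THEN conjunct2, THEN conjunct1, THEN spec])
  show "B u (v \<cdot> w) = B (u \<cdot> v) w"
    by (rule B[THEN conjunct2, THEN conjunct2, THEN spec, THEN spec, THEN spec])
qed

text \<open>As \<open>a\<close> is idempotent, associativity gives \<open>B a v = l * B a v\<close>
  for an l-eigenvector \<open>v\<close>, so \<open>B a\<close> vanishes on the \<alpha>- and
  \<beta>-components. This yields uniqueness of the normalised form.\<close>

lemma frobenius_form_coeff1:
  assumes B: "frobenius_form B" and a: "prim a" "B a a = 1"
  shows "B a x = coeff1 a x"
proof -
  have add: "B y (u + v) = B y u + B y v" and scale: "B y (l *s u) = l * B y u" for y u v l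
    using frobenius_formD(1)[OF B] by (simp_all add: linear_to_field_iff)
  have orth: "B a v = 0" if "v \<in> eigenspace l a" "l \<noteq> 1" for l v
  proof -
    have "B a v = B a (a \<cdot> v)"
      by (simp add: frobenius_formD(3)[OF B] prim_idem[OF a(1)])
    also have "\<dots> = l * B a v"
      using that by (simp add: eigenspace_def scale)
    finally show ?thesis
      using that(2) by simp
  qed
  obtain l v w where x: "v \<in> eigenspace \<alpha> a" "w \<in> eigenspace \<beta> a" "x = l *s a + v + w"
    by (rule prim_decomposition[OF a(1)])
  then show ?thesis
    using coeff1_decomposition[OF a(1) x(1,2)] orth params a(2) by (simp add: add scale)
qed

text \<open>The bilinear extension is a normalised Frobenius form, and any other one has the same
  values on the spanning set of axes. Hence the definite description in \<open>the_form\<close> is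
  meaningful.\<close>

lemma the_form_coeff1:
  assumes span: "span (Collect prim) = UNIV" and a: "prim a"
  shows "the_form \<alpha> \<beta> a x = coeff1 a x"
proof -
  obtain B where B: "\<And>p x. prim p \<Longrightarrow> B p x = coeff1 p x" "\<And>u v. B u v = B v u"
    and lin: "\<And>u. Vector_Spaces.linear (*s) (*) (B u)"
    using bilinear_extension_exists[OF span] by blast
  have norm: "B p p = 1" if "prim p" for p
    using that B(1) coeff1_self by simp
  have lin': "Vector_Spaces.linear (*s) (*) (\<lambda>u. B u v)" for v
    using lin by (subst B(2))
  have "\<exists>u v. B u v \<noteq> 0"
    using norm[OF a] by (metis zero_neq_one)
  then have frob: "frobenius_form B"
    unfolding frobenius_form_def
    by (intro conjI allI lin lin' B(2) bilinear_extension_frobenius[OF span B lin])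
  have unique: "C = B" if C: "frobenius_form C" "\<forall>p. prim p \<longrightarrow> C p p = 1" for C
  proof (intro ext)
    fix u v
    show "C u v = B u v"
    proof (rule linear_eq_on_prim[OF span, where x = u])
      show "Vector_Spaces.linear (*s) (*) (\<lambda>u. C u v)"
        by (rule frobenius_formD(2)[OF C(1)])
      show "C p v = B p v" if "prim p" for p
        using frobenius_form_coeff1[OF C(1) that] C(2) B(1) that by simp
    qed (rule lin')
  qed
  have "the_form \<alpha> \<beta> = B"
    unfolding the_form_def
  proof (rule the_equality)
    show "frobenius_form B \<and> (\<forall>a. prim a \<longrightarrow> B a a = 1)"
      using frob norm by blast
  qed (elim conjE, rule unique)
  then show ?thesis
    using B(1)[OF a] by simp
qed

subsection \<open>The eigenspaces of a generator\<close>

text \<open>The fixed vectors of the involution form the even part; a vanishing coefficient excludes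
  a component along \<open>a\<close>.\<close>

lemma in_alpha_eigenspace:
  assumes a: "prim a" and x: "\<tau> a x = x" "coeff1 a x = 0"
  shows "x \<in> eigenspace \<alpha> a"
proof -
  have "a \<cdot> x = ((\<alpha> + \<beta>) / 2 + (\<alpha> - \<beta>) / 2) *s x"
    by (simp add: mult_miyamoto[OF a, of x] x scale_left_distrib)
  then show ?thesis
    by (simp add: halves eigenspace_def)
qed

text \<open>The coefficient is invariant under the involution, so on a negated vector it equals its
  own negative and vanishes.\<close>

lemma in_beta_eigenspace:
  assumes a: "prim a" and x: "\<tau> a x = - x"
  shows "x \<in> eigenspace \<beta> a"
proof -
  have "coeff1 a x = - coeff1 a x"
    using coeff1_miyamoto[OF a, of x] by (simp add: x coeff1_minus[OF a])
  then have "2 * coeff1 a x = 0"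
    by (metis add.right_inverse mult_2)
  then have "a \<cdot> x = ((\<alpha> + \<beta>) / 2 - (\<alpha> - \<beta>) / 2) *s x"
    using two_neq_0 by (simp add: mult_miyamoto[OF a, of x] x scale_left_diff_distrib)
  then show ?thesis
    by (simp add: halves eigenspace_def)
qed

text \<open>If the given eigenvectors together with \<open>a\<close> span the algebra, uniqueness of
  the decomposition leaves no room for eigenvectors outside their spans.\<close>

lemma eigenspaces_eq_span:
  assumes a: "prim a" and S: "S \<subseteq> eigenspace \<alpha> a" and R: "R \<subseteq> eigenspace \<beta> a"
    and span: "span (insert a (S \<union> R)) = UNIV"
  shows "eigenspace \<alpha> a = span S" "eigenspace \<beta> a = span R"
proof -
  have le: "span S \<subseteq> eigenspace \<alpha> a" "span R \<subseteq> eigenspace \<beta> a"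
    using S R span_minimal subspace_eigenspace by blast+
  have dec: "\<exists>l. \<exists>v\<in>span S. \<exists>w\<in>span R. x = l *s a + v + w" for x
  proof -
    obtain l where "x - l *s a \<in> span (S \<union> R)"
      using span span_breakdown_eq[of x a "S \<union> R"] by auto
    then obtain v w where "x - l *s a = v + w" "v \<in> span S" "w \<in> span R"
      by (auto simp: span_Un)
    then show ?thesis
      by (metis add.assoc add.commute diff_add_cancel)
  qed
  have zero: "0 \<in> eigenspace m a" for m
    by (rule subspace_0[OF subspace_eigenspace])
  have "x \<in> span S" if x: "x \<in> eigenspace \<alpha> a" for x
  proof -
    obtain l v w where "v \<in> span S" "w \<in> span R" "x = l *s a + v + w"
      using dec by blast
    moreover from this have "x = v"
      using le by (intro prim_decomposition_unique(2)[OF a x zero, of v w 0 l]) auto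
    ultimately show ?thesis
      by simp
  qed
  then show "eigenspace \<alpha> a = span S"
    using le by blast
  have "x \<in> span R" if x: "x \<in> eigenspace \<beta> a" for x
  proof -
    obtain l v w where "v \<in> span S" "w \<in> span R" "x = l *s a + v + w"
      using dec by blast
    moreover from this have "x = w"
      using le by (intro prim_decomposition_unique(3)[OF a zero x, of v w 0 l]) auto
    ultimately show ?thesis
      by simp
  qed
  then show "eigenspace \<beta> a = span R"
    using le by blast
qed

section \<open>Coefficients of the words and the meaning of the two polynomials\<close>

text \<open>Transport by the involution of \<open>b\<close> moves it from one argument to the other;
  symmetry on axes then exchanges the arguments.\<close>

lemma coeff1_miyamoto_cycle:
  assumes "prim a" "prim b" "prim c"
  shows "coeff1 c (\<tau> b a) = coeff1 a (\<tau> b c)"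
  using assms coeff1_automorphism[OF miyamoto_automorphism[of b], of a "\<tau> b c"]
    coeff1_sym[of c "\<tau> b a"] by (simp add: prim_miyamoto miyamoto_miyamoto)

lemma coeff1_miyamoto_swap:
  assumes a: "prim a" and b: "prim b" and c: "prim c"
  shows "coeff1 c (\<tau> a b) = coeff1 a (\<tau> b c) + swap_coeff (coeff1 a b) * (coeff1 b c - coeff1 a c)"
  using miyamoto_swap[OF a b] coeff1_miyamoto_cycle[OF a b c] coeff1_sym[OF c] a b
  by (simp add: coeff1_simps c)

text \<open>The cycle rule, applied with \<open>\<tau> a c\<close> in place of \<open>c\<close>,
  gives a pairing with \<open>\<tau> b a\<close>. After an exchange to \<open>\<tau> a b\<close>,
  the involution of \<open>a\<close> is cancelled in both arguments.\<close>

lemma coeff1_miyamoto_miyamoto: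
  assumes a: "prim a" and b: "prim b" and c: "prim c"
  shows "coeff1 a (\<tau> b (\<tau> a c)) =
    coeff1 b c + swap_coeff (coeff1 a b) * (coeff1 a c - coeff1 c (\<tau> a b))"
proof -
  have ac: "prim (\<tau> a c)"
    by (rule prim_miyamoto[OF a c])
  have "coeff1 a (\<tau> b (\<tau> a c)) = coeff1 (\<tau> a c) (\<tau> b a)"
    by (rule coeff1_miyamoto_cycle[OF a b ac, symmetric])
  also have "\<dots> = coeff1 (\<tau> a c) (\<tau> a b) + swap_coeff (coeff1 a b) * (coeff1 (\<tau> a c) a - coeff1 (\<tau> a c) b)"
    by (simp add: miyamoto_swap[OF b a] coeff1_simps[OF ac] coeff1_sym[OF b a])
  also have "coeff1 (\<tau> a c) (\<tau> a b) = coeff1 b c"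
    using coeff1_automorphism[OF miyamoto_automorphism[OF a] c] coeff1_sym[OF b c] by simp
  also have "coeff1 (\<tau> a c) a = coeff1 a c"
    using coeff1_sym[OF ac a] coeff1_miyamoto[OF a] by simp
  also have "coeff1 (\<tau> a c) b = coeff1 c (\<tau> a b)"
    using coeff1_sym[OF ac b] coeff1_miyamoto_cycle[OF c a b] by simp
  finally show ?thesis .
qed

text \<open>The argument of the outer \<open>swap_coeff\<close> is (c, [a]b) in terms of the four
  parameters. So t / (\<alpha> - \<beta>)^2 is minus the correction factor of
  \<open>miyamoto_triple\<close>.\<close>

lemma coeff_t_eq:
  "coeff_t \<alpha> \<beta> \<delta> \<theta> \<gamma> \<omega> = - swap_coeff (\<omega> + swap_coeff \<delta> * (\<gamma> - \<theta>)) * (\<alpha> - \<beta>)^2"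
proof -
  \<comment> \<open>One factor \<open>q\<close> clears the denominator of the outer
    \<open>swap_coeff\<close>, the other that of the inner one hidden in \<open>r\<close>.\<close>
  define q r where "q = \<alpha> - \<beta>" and "r = \<omega> + swap_coeff \<delta> * (\<gamma> - \<theta>)"
  have swap: "swap_coeff l * q = 2 * (1 - \<alpha>) * l - (\<alpha> + \<beta>)" for l
    using params by (simp add: swap_coeff_def q_def)
  have qr: "q * r = q * \<omega> + (2 * (1 - \<alpha>) * \<delta> - (\<alpha> + \<beta>)) * (\<gamma> - \<theta>)"
    unfolding swap[symmetric] by (simp add: r_def algebra_simps)
  have "- swap_coeff r * q^2 = - (swap_coeff r * q) * q"
    by (simp add: power2_eq_square)
  also have "\<dots> = - 2 * (1 - \<alpha>) * (q * r) + (\<alpha> + \<beta>) * q"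
    unfolding swap by (simp add: algebra_simps)
  also have "\<dots> = coeff_t \<alpha> \<beta> \<delta> \<theta> \<gamma> \<omega>"
    unfolding qr by (simp add: q_def coeff_t_def power2_eq_square algebra_simps)
  finally show ?thesis
    by (simp add: q_def r_def)
qed

text \<open>With k = \<open>swap_coeff r\<close>, the bracket is the coefficient of \<open>a\<close>
  in k (b + c) + [b,a]c + [c,a]b. Thus t1 is exactly what makes the fourth \<alpha>-eigenvector
  orthogonal to \<open>a\<close>.\<close>

lemma coeff_t1_eq:
  assumes r: "r = \<omega> + swap_coeff \<delta> * (\<gamma> - \<theta>)"
  shows "coeff_t1 \<alpha> \<beta> \<delta> \<theta> \<gamma> \<omega> =
    - (2 * \<gamma> + swap_coeff \<delta> * (\<theta> - r) + swap_coeff \<theta> * (\<delta> - r) + swap_coeff r * (\<delta> + \<theta>)) * (\<alpha> - \<beta>)^2"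
proof -
  define q where "q = \<alpha> - \<beta>"
  have swap: "swap_coeff l * q = 2 * (1 - \<alpha>) * l - (\<alpha> + \<beta>)" for l
    using params by (simp add: swap_coeff_def q_def)
  have qr: "q * r = q * \<omega> + (2 * (1 - \<alpha>) * \<delta> - (\<alpha> + \<beta>)) * (\<gamma> - \<theta>)"
    unfolding swap[symmetric] by (simp add: r algebra_simps)
  have "(2 * \<gamma> + swap_coeff \<delta> * (\<theta> - r) + swap_coeff \<theta> * (\<delta> - r) + swap_coeff r * (\<delta> + \<theta>)) * q^2
    = 2 * \<gamma> * q^2 + (swap_coeff \<delta> * q) * (\<theta> * q - q * r) + (swap_coeff \<theta> * q) * (\<delta> * q - q * r)
      + (swap_coeff r * q) * (\<delta> + \<theta>) * q"
    by (simp add: power2_eq_square algebra_simps)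
  also have "\<dots> = 2 * \<gamma> * q^2 + (2 * (1 - \<alpha>) * \<delta> - (\<alpha> + \<beta>)) * (\<theta> * q - q * r)
      + (2 * (1 - \<alpha>) * \<theta> - (\<alpha> + \<beta>)) * (\<delta> * q - q * r)
      + (2 * (1 - \<alpha>) * (q * r) - (\<alpha> + \<beta>) * q) * (\<delta> + \<theta>)"
    unfolding swap by (simp add: algebra_simps)
  also have "\<dots> = - coeff_t1 \<alpha> \<beta> \<delta> \<theta> \<gamma> \<omega>"
    unfolding qr by (simp add: q_def coeff_t1_def power2_eq_square algebra_simps)
  finally show ?thesis
    by (simp only: q_def mult_minus_left minus_minus)
qed

text \<open>For each word x, the sum of x and its image under \<open>\<tau> a\<close>, minus its
  \<open>a\<close>-component, is an \<alpha>-eigenvector, and the difference is a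
  \<beta>-eigenvector. For [b,a]c and [c,a]b, which are interchanged only up to a multiple of k, the
  terms in \<open>b\<close> and \<open>c\<close> compensate the defect.\<close>

lemma eigenspaces_three_generated:
  fixes a b c
  defines "\<delta> \<equiv> coeff1 a b" and "\<theta> \<equiv> coeff1 a c" and "\<gamma> \<equiv> coeff1 b c" and "\<omega> \<equiv> coeff1 a (\<tau> b c)"
  defines "t \<equiv> coeff_t \<alpha> \<beta> \<delta> \<theta> \<gamma> \<omega>" and "t\<^sub>1 \<equiv> coeff_t1 \<alpha> \<beta> \<delta> \<theta> \<gamma> \<omega>"
  assumes a: "prim a" and b: "prim b" and c: "prim c" and gen: "generates {a, b, c}"
  shows "eigenspace \<alpha> a = span
      {(- 2 * \<delta>) *s a + b + \<tau> a b,
       (- 2 * \<theta>) *s a + c + \<tau> a c,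
       (- 2 * \<omega>) *s a + \<tau> b c + \<tau> a (\<tau> b c),
       (1 / (\<alpha> - \<beta>)^2) *s (t\<^sub>1 *s a - t *s (b + c)) + \<tau> b (\<tau> a c) + \<tau> c (\<tau> a b)}" (is "_ = span ?S")
    and "eigenspace \<beta> a = span
      {- b + \<tau> a b,
       - c + \<tau> a c,
       - \<tau> b c + \<tau> a (\<tau> b c),
       (t / (\<alpha> - \<beta>)^2) *s (b - c) - \<tau> b (\<tau> a c) + \<tau> c (\<tau> a b)}" (is "_ = span ?R")
proof -
  define r k n where "r = \<omega> + swap_coeff \<delta> * (\<gamma> - \<theta>)" and "k = swap_coeff r"
    and "n = - (2 * \<gamma> + swap_coeff \<delta> * (\<theta> - r) + swap_coeff \<theta> * (\<delta> - r) + k * (\<delta> + \<theta>))"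
  have t: "t / (\<alpha> - \<beta>)^2 = - k"
    unfolding t_def coeff_t_eq using params by (simp add: r_def k_def)
  have t1: "t\<^sub>1 / (\<alpha> - \<beta>)^2 = n"
    unfolding t\<^sub>1_def coeff_t1_eq[OF r_def] using params by (simp add: n_def k_def)
  have rc: "coeff1 c (\<tau> a b) = r"
    by (simp add: coeff1_miyamoto_swap[OF a b c] r_def \<delta>_def \<theta>_def \<gamma>_def \<omega>_def)
  then have rb: "coeff1 b (\<tau> a c) = r"
    using coeff1_miyamoto_cycle[OF b a c] by simp
  have aba: "\<tau> a (\<tau> b (\<tau> a c)) = \<tau> c (\<tau> a b) + k *s (c - \<tau> a b)"
    using miyamoto_triple[OF a b c] by (simp add: rc k_def)
  have aca: "\<tau> a (\<tau> c (\<tau> a b)) = \<tau> b (\<tau> a c) + k *s (b - \<tau> a c)"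
    using miyamoto_triple[OF a c b] by (simp add: rb k_def)
  have u_eq: "(1 / (\<alpha> - \<beta>)^2) *s (t\<^sub>1 *s a - t *s (b + c)) = n *s a + k *s (b + c)"
    using t t1 by (simp add: scale_right_diff_distrib)
  have two: "x + x = 2 *s x" for x
    by (metis one_add_one scale_left_distrib scale_one)
  note simps = miyamoto_simps[OF a] miyamoto_miyamoto[OF a] miyamoto_self[OF a] coeff1_simps[OF a]
    coeff1_miyamoto[OF a] coeff1_self[OF a] aba aca
  have "coeff1 a (\<tau> b (\<tau> a c)) = \<gamma> + swap_coeff \<delta> * (\<theta> - r)"
    using coeff1_miyamoto_miyamoto[OF a b c] by (simp add: rc \<delta>_def \<theta>_def \<gamma>_def)
  moreover have "coeff1 a (\<tau> c (\<tau> a b)) = \<gamma> + swap_coeff \<theta> * (\<delta> - r)"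
    using coeff1_miyamoto_miyamoto[OF a c b] coeff1_sym[OF b c] by (simp add: rb \<delta>_def \<theta>_def \<gamma>_def)
  ultimately have S: "?S \<subseteq> eigenspace \<alpha> a"
    unfolding u_eq using \<delta>_def \<theta>_def \<omega>_def
    by (auto intro!: in_alpha_eigenspace[OF a] simp: simps n_def algebra_simps)
  have R: "?R \<subseteq> eigenspace \<beta> a"
    unfolding t by (auto intro!: in_beta_eigenspace[OF a] simp: simps algebra_simps)
  let ?V = "span (insert a (?S \<union> ?R))"
  have base: "x \<in> ?V" if "x \<in> insert a (?S \<union> ?R)" for x
    using that by (rule span_base)
  have aV: "a \<in> ?V"
    by (rule base) simp
  \<comment> \<open>Conversely, each word is recovered from its symmetric and antisymmetric
    combinations by dividing by 2.\<close>
  have half: "x \<in> ?V" "y \<in> ?V" if "l *s a + x + y \<in> ?V" "- x + y \<in> ?V" for l x y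
  proof -
    have "(1 / 2) *s ((l *s a + x + y) - l *s a - (- x + y)) \<in> ?V"
      using that aV by (intro span_scale span_diff)
    then show x: "x \<in> ?V"
      using two_neq_0 by (simp add: two)
    show "y \<in> ?V"
      using span_add[OF that(2) x] by simp
  qed
  have bV: "b \<in> ?V" "\<tau> a b \<in> ?V"
    by (rule half[of "- 2 * \<delta>" b "\<tau> a b"]; rule base; simp)+
  have cV: "c \<in> ?V" "\<tau> a c \<in> ?V"
    by (rule half[of "- 2 * \<theta>" c "\<tau> a c"]; rule base; simp)+
  have bcV: "\<tau> b c \<in> ?V" "\<tau> a (\<tau> b c) \<in> ?V"
    by (rule half[of "- 2 * \<omega>" "\<tau> b c" "\<tau> a (\<tau> b c)"]; rule base; simp)+
  \<comment> \<open>The corrections in \<open>b\<close> and \<open>c\<close> already lie in the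
    span; removing them brings the last pair into the shape required by \<open>half\<close>.\<close>
  have "n *s a + k *s (b + c) + \<tau> b (\<tau> a c) + \<tau> c (\<tau> a b) \<in> ?V"
    by (rule base) (simp add: u_eq)
  from span_diff[OF this span_scale[OF span_add[OF bV(1) cV(1)], of k]]
  have plus: "n *s a + \<tau> b (\<tau> a c) + \<tau> c (\<tau> a b) \<in> ?V"
    by (simp add: algebra_simps)
  have "(- k) *s (b - c) - \<tau> b (\<tau> a c) + \<tau> c (\<tau> a b) \<in> ?V"
    by (rule base) (simp add: t)
  from span_add[OF this span_scale[OF span_diff[OF bV(1) cV(1)], of k]]
  have minus: "- \<tau> b (\<tau> a c) + \<tau> c (\<tau> a b) \<in> ?V"
    by (simp add: algebra_simps)
  have "word_span a b c \<subseteq> ?V"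
    unfolding word_span_def using aV bV cV bcV half[OF plus minus]
    by (intro span_minimal subspace_span) auto
  then have "?V = UNIV"
    using word_span_eq_UNIV[OF a b c gen] by auto
  then show "eigenspace \<alpha> a = span ?S" "eigenspace \<beta> a = span ?R"
    by (rule eigenspaces_eq_span[OF a S R])+
qed

lemma span_prim_eq_UNIV:
  assumes "prim a" "prim b" "prim c" "generates {a, b, c}"
  shows "span (Collect prim) = UNIV"
proof -
  have "word_span a b c \<subseteq> span (Collect prim)"
    unfolding word_span_def using assms(1-3) by (intro span_mono) (auto simp: prim_miyamoto)
  then show ?thesis
    using word_span_eq_UNIV[OF assms] by auto
qed

end

theorem mainTheorem1:
  fixes scale :: "'f::field \<Rightarrow> 'a::ab_group_add \<Rightarrow> 'a"  (infixr "\<odot>" 75)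
    and mult :: "'a \<Rightarrow> 'a \<Rightarrow> 'a"
    and \<alpha> \<beta> \<delta> \<theta> \<gamma> \<omega> t t\<^sub>1 :: 'f
    and a b c :: 'a
    and T :: "'a list \<Rightarrow> 'a \<Rightarrow> 'a"
    and form :: "'a \<Rightarrow> 'a \<Rightarrow> 'f"
  assumes alg: "comm_algebra (\<odot>) mult"
    and char_not_2: "(2::'f) \<noteq> 0"
    and params: "\<alpha> \<noteq> \<beta>" "\<alpha> \<noteq> 1" "\<beta> \<noteq> 1"
    and axial: "comm_algebra.primitive_axial_algebra (\<odot>) mult \<alpha> \<beta>"
    and star: "comm_algebra.star_condition (\<odot>) mult \<alpha> \<beta>"
    and axes: "comm_algebra.primitive_axis (\<odot>) mult \<alpha> \<beta> a"
              "comm_algebra.primitive_axis (\<odot>) mult \<alpha> \<beta> b"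
              "comm_algebra.primitive_axis (\<odot>) mult \<alpha> \<beta> c"
    and gen: "comm_algebra.generates (\<odot>) mult {a, b, c}"
    and T_eq: "T = comm_algebra.miyamotos (\<odot>) mult \<alpha> \<beta>"
    and form_eq: "form = comm_algebra.the_form (\<odot>) mult \<alpha> \<beta>"
    and \<delta>_eq: "\<delta> = form a b"
    and \<theta>_eq: "\<theta> = form a c"
    and \<gamma>_eq: "\<gamma> = form b c"
    and \<omega>_eq: "\<omega> = form a (T [b] c)"
    and t\<^sub>1_eq: "t\<^sub>1 = coeff_t1 \<alpha> \<beta> \<delta> \<theta> \<gamma> \<omega>"
    and t_eq: "t = coeff_t \<alpha> \<beta> \<delta> \<theta> \<gamma> \<omega>"
  shows "module.span (\<odot>)
           {a, b, c, T [a] b, T [a] c, T [b] c, T [a, b] c, T [b, a] c, T [c, a] b} = UNIV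
       \<and> comm_algebra.eigenspace (\<odot>) mult \<alpha> a =
           module.span (\<odot>)
             {(- 2 * \<delta>) \<odot> a + b + T [a] b,
              (- 2 * \<theta>) \<odot> a + c + T [a] c,
              (- 2 * \<omega>) \<odot> a + T [b] c + T [a, b] c,
              (1 / (\<alpha> - \<beta>)^2) \<odot> (t\<^sub>1 \<odot> a - t \<odot> (b + c)) + T [b, a] c + T [c, a] b}
       \<and> comm_algebra.eigenspace (\<odot>) mult \<beta> a =
           module.span (\<odot>)
             {- b + T [a] b,
              - c + T [a] c,
              - T [b] c + T [a, b] c,
              (t / (\<alpha> - \<beta>)^2) \<odot> (b - c) - T [b, a] c + T [c, a] b}"
proof -
  interpret star_algebra "(\<odot>)" mult \<alpha> \<beta>
    by (intro star_algebra.intro star_algebra_axioms.intro alg char_not_2 params star)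
  have T: "T [x] y = \<tau> x y" "T [x, z] y = \<tau> x (\<tau> z y)" for x y z
    by (simp_all add: T_eq miyamotos_def)
  have form: "form x y = coeff1 x y" if "prim x" for x y
    unfolding form_eq by (rule the_form_coeff1[OF span_prim_eq_UNIV[OF axes gen] that])
  show ?thesis
    using word_span_eq_UNIV[OF axes gen] eigenspaces_three_generated[OF axes gen]
    unfolding word_span_def T t_eq t\<^sub>1_eq \<delta>_eq \<theta>_eq \<gamma>_eq \<omega>_eq form[OF axes(1)] form[OF axes(2)]
    by (intro conjI)
qed

end
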